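(* Let $\mathcal{B}$ be the set of all $\beta(1,0)$-trees and let $h:\mathcal{B}\to\mathcal{B}$ be the involution defined recursively by $h(\bullet)=\bullet$, $h(\lambda_i t)=\gamma_i h(t)$ for $t\in\mathcal{B}$ and $1\le i\le \operatorname{root} t$, and $h(u\oplus v)=h(v)\oslash h(u)$ for $u,v\in\mathcal{B}\setminus\{\bullet\}$. Then $h$ sends the tuple of statistics $(\mathrm{leaves},\mathrm{int},\mathrm{root},\mathrm{rpath},\mathrm{sub},\mathrm{rsub})$ to $(\mathrm{int},\mathrm{leaves},\mathrm{rpath},\mathrm{root},\mathrm{rsub},\mathrm{sub})$ on trees with at least one edge; that is, for every $\beta(1,0)$-tree $t$ with at least one edge, $$\mathrm{leaves}\,t=\mathrm{int}\,h(t),\quad \mathrm{int}\,t=\mathrm{leaves}\,h(t),\quad \mathrm{root}\,t=\mathrm{rpath}\,h(t),$$ $$\mathrm{rpath}\,t=\mathrm{root}\,h(t),\quad \mathrm{sub}\,t=\mathrm{rsub}\,h(t),\quad \mathrm{rsub}\,t=\mathrm{sub}\,h(t).$$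
   Context: A $\beta(1,0)$-tree is a rooted plane tree (children of each node are linearly ordered left to right) whose nodes are labeled with positive integers such that: (1) leaves have label $1$; (2) the root has label equal to the sum of its children's labels; (3) any other non-leaf node has label no greater than the sum of its children's labels. The single-node tree, whose only node has label $1$, is a $\beta(1,0)$-tree and is denoted $\bullet$ (it is exempt from (2)). $\mathcal{B}$ is the set of all $\beta(1,0)$-trees. Statistics of a $\beta(1,0)$-tree $t$: $\mathrm{root}\,t$ is the label of the root; the right path of $t$ is the path from the root to the rightmost leaf (always go to the last child), and $\mathrm{rpath}\,t$ is its number of edges; $\mathrm{leaves}\,t$ is the number of leaves; $\mathrm{int}\,t$ is the number of internal (non-leaf) nodes, the root included; $\mathrm{sub}\,t$ is the number of children of the root; $\mathrm{rsub}\,t$ is the number of nodes labeled $1$ on the right path strictly below the root (the rightmost leaf is counted). Operations: - For $u,v\in\mathcal{B}\setminus\{\bullet\}$, $u\oplus v$ is the tree obtained by identifying the roots: its root label is $\operatorname{root} u+\operatorname{root} v$, and the subtrees at its root are those of $u$ followed by those of $v$. - For $t\in\mathcal{B}$ and $1\le i\le\operatorname{root} t$, $\lambda_i t$ is obtained from $t$ by adding a new root whose only child is the old root; both the new root and the old root are assigned the label $i$. - For $u,v\in\mathcal{B}\setminus\{\bullet\}$, $u\oslash v$ is obtained by identifying the rightmost leaf of $u$ with the root of $v$; the identified node gets label $1$, and all other labels are kept. - For $t\in\mathcal{B}\setminus\{\bullet\}$ and $1\le i\le \operatorname{rpath} t$, let $x$ be the $i$th node on the right path of $t$ (the root being the first).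 Then $\gamma_i t$ is obtained by attaching to $x$ a new leaf (label $1$) as the new last child of $x$, and adding $1$ to the label of each node on the path from the root to $x$ (inclusive). By convention $\gamma_1\bullet$ is the tree with two nodes, both labeled $1$. The operations $\oplus$ and $\oslash$ are associative. Every $\beta(1,0)$-tree is of exactly one of the forms $\bullet$; $\lambda_i u$ with $u\in\mathcal{B}$, $1\le i\le\operatorname{root}u$ (root has exactly one child; $i$ and $u$ are then unique); $u\oplus v$ with $u,v\neq\bullet$ (root has at least two children; the decomposition into a sum of trees of the form $\lambda_i u$ is unique). Hence the recursion determines $h$ (the well-definedness of $\gamma_i h(t)$ for $t\neq\bullet$ uses $\operatorname{rpath} h(t)=\operatorname{root} t$, established along the same recursion). *)

theory Defs
  imports Main "HOL-Library.FuncSet"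
begin

datatype tree = Node (root_label: nat) (children: "tree list")

abbreviation bullet :: tree
  where "bullet \<equiv> Node 1 []"

lemma size_mem_children: "c \<in> set cs \<Longrightarrow> size c < Suc (size_list size cs)"
  by (induction cs) auto

lemma size_last_children [termination_simp]:
  "cs \<noteq> [] \<Longrightarrow> size (last cs) < Suc (size_list size cs)"
  by (simp add: size_mem_children)

definition label_sum :: "tree list \<Rightarrow> nat"
  where "label_sum cs = sum_list (map root_label cs)"

text \<open>The labelling conditions at and below a node that is not the root of the whole tree.\<close>

fun nonroot_ok :: "tree \<Rightarrow> bool"
  where "nonroot_ok (Node l cs) \<longleftrightarrow>
    1 \<le> l \<and> (if cs = [] then l = 1 else l \<le> label_sum cs) \<and> (\<forall>c\<in>set cs. nonroot_ok c)"

fun beta10_tree :: "tree \<Rightarrow> bool"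
  where "beta10_tree (Node l cs) \<longleftrightarrow>
    1 \<le> l \<and> (if cs = [] then l = 1 else l = label_sum cs) \<and> (\<forall>c\<in>set cs. nonroot_ok c)"

definition \<B> :: "tree set"
  where "\<B> = {t. beta10_tree t}"

text \<open>The labels on the right path, listed from the root to the rightmost leaf.\<close>

fun right_path_labels :: "tree \<Rightarrow> nat list"
  where "right_path_labels (Node l cs) = l # (if cs = [] then [] else right_path_labels (last cs))"

definition rpath :: "tree \<Rightarrow> nat"
  where "rpath t = length (right_path_labels t) - 1"

definition rsub :: "tree \<Rightarrow> nat"
  where "rsub t = length (filter (\<lambda>l. l = 1) (tl (right_path_labels t)))"

definition root_sub :: "tree \<Rightarrow> nat"
  where "root_sub t = length (children t)"

fun leaves :: "tree \<Rightarrow> nat"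
  where "leaves (Node l cs) = (if cs = [] then 1 else sum_list (map leaves cs))"

fun internals :: "tree \<Rightarrow> nat"
  where "internals (Node l cs) = (if cs = [] then 0 else 1 + sum_list (map internals cs))"

text \<open>
  All operations are total functions on \<^typ>\<open>tree\<close>; their values outside the stated
  ranges of the arguments carry no meaning.
\<close>

fun oplus :: "tree \<Rightarrow> tree \<Rightarrow> tree" (infixl "\<oplus>" 65)
  where "Node a cs \<oplus> Node b ds = Node (a + b) (cs @ ds)"

fun lam :: "nat \<Rightarrow> tree \<Rightarrow> tree"
  where "lam i (Node l cs) = Node i [Node i cs]"

fun oslash :: "tree \<Rightarrow> tree \<Rightarrow> tree" (infixl "\<oslash>" 70)
  where "Node l cs \<oslash> v =
    (if cs = [] then Node 1 (children v) else Node l (butlast cs @ [last cs \<oslash> v]))"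

text \<open>
  \<open>attach i t\<close> increments the labels of the first \<open>i\<close> nodes of the right path and gives the
  \<open>i\<close>th of them (counting from 1) a new last child.
\<close>

fun attach :: "nat \<Rightarrow> tree \<Rightarrow> tree"
  where
    "attach 0 t = t"
  | "attach (Suc 0) (Node l cs) = Node (l + 1) (cs @ [bullet])"
  | "attach (Suc (Suc i)) (Node l cs) =
      Node (l + 1) (if cs = [] then [] else butlast cs @ [attach (Suc i) (last cs)])"

definition gam :: "nat \<Rightarrow> tree \<Rightarrow> tree"
  where "gam i t = (if t = bullet then Node 1 [bullet] else attach i t)"

text \<open>
  In \<^term>\<open>lam i u\<close> the label of the old root is overwritten; it is recovered from \<open>u \<in> \<B>\<close>
  as the sum of the labels of its children.
\<close>

definition root_tree :: "tree list \<Rightarrow> tree"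
  where "root_tree cs = Node (if cs = [] then 1 else label_sum cs) cs"

text \<open>
  The third equation splits off the first summand of the finest decomposition with respect to
  \<open>\<oplus>\<close>. The general recursion for \<open>h (u \<oplus> v)\<close> is \<open>h_oplus\<close> below; \<open>h_bullet\<close>, \<open>h_lam\<close> and
  \<open>h_oplus\<close> characterise \<open>h\<close> on \<open>\<B>\<close> by \<open>h_unique\<close>.
\<close>

function h :: "tree \<Rightarrow> tree"
  where
    "h (Node l []) = bullet"
  | "h (Node l [c]) = gam l (h (root_tree (children c)))"
  | "h (Node l (c # d # cs)) = h (root_tree (d # cs)) \<oslash> h (root_tree [c])"
  by pat_completeness auto
termination
proof (relation "measure size", goal_cases)
  case (2 l c)
  then show ?case by (cases c) (simp add: root_tree_def)
qed (simp_all add: root_tree_def)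

lemma oslash_assoc: "u \<oslash> v \<oslash> w = u \<oslash> (v \<oslash> w)"
proof (induction u v rule: oslash.induct)
  case (1 l cs v)
  show ?case
  proof (cases "cs = []")
    case True
    then show ?thesis by (cases v) simp
  next
    case False
    with 1 show ?thesis by simp
  qed
qed

lemma root_tree_beta: "u \<in> \<B> \<Longrightarrow> root_tree (children u) = u"
  by (cases u) (auto simp: \<B>_def root_tree_def split: if_splits)

lemma h_bullet: "h bullet = bullet"
  by simp

lemma h_lam:
  assumes "t \<in> \<B>" "1 \<le> i" "i \<le> root_label t"
  shows "h (lam i t) = gam i (h t)"
  using root_tree_beta[OF assms(1)] by (cases t) simp

lemma h_root_tree_append:
  "cs \<noteq> [] \<Longrightarrow> ds \<noteq> [] \<Longrightarrow>
    h (root_tree (cs @ ds)) = h (root_tree ds) \<oslash> h (root_tree cs)"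
proof (induction cs)
  case Nil
  then show ?case by simp
next
  case (Cons c cs)
  have *: "h (root_tree (c # es)) = h (root_tree es) \<oslash> h (root_tree [c])" if "es \<noteq> []" for es
    using that by (cases es) (simp_all add: root_tree_def[of "c # _"])
  show ?case
  proof (cases "cs = []")
    case True
    then show ?thesis using * Cons.prems by simp
  next
    case False
    then show ?thesis using *[of cs] *[of "cs @ ds"] Cons by (simp add: oslash_assoc)
  qed
qed

lemma children_nonempty: "u \<in> \<B> - {bullet} \<Longrightarrow> children u \<noteq> []"
proof (cases u)
  case (Node l cs)
  assume "u \<in> \<B> - {bullet}"
  then show ?thesis unfolding Node by (cases "cs = []") (simp_all add: \<B>_def)
qed

lemma h_oplus:
  assumes "u \<in> \<B> - {bullet}" "v \<in> \<B> - {bullet}"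
  shows "h (u \<oplus> v) = h v \<oslash> h u"
proof -
  have ne: "children u \<noteq> []" "children v \<noteq> []"
    by (rule assms[THEN children_nonempty])+
  have eq: "root_tree (children u) = u" "root_tree (children v) = v"
    using assms by (auto intro: root_tree_beta)
  have "u \<oplus> v = root_tree (children u) \<oplus> root_tree (children v)"
    by (simp only: eq)
  also have "\<dots> = root_tree (children u @ children v)"
    using ne by (simp add: root_tree_def label_sum_def)
  finally show ?thesis
    using h_root_tree_append[OF ne] by (simp only: eq)
qed

lemma root_tree_in_beta:
  assumes "\<forall>c\<in>set cs. nonroot_ok c"
  shows "root_tree cs \<in> \<B>"
proof (cases cs)
  case (Cons c ds)
  then have "1 \<le> root_label c" using assms by (cases c) auto
  then show ?thesis using assms Cons by (auto simp: \<B>_def root_tree_def label_sum_def)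
qed (simp add: \<B>_def root_tree_def)

lemma h_unique:
  assumes "f bullet = bullet"
    and "\<And>i t. t \<in> \<B> \<Longrightarrow> 1 \<le> i \<Longrightarrow> i \<le> root_label t \<Longrightarrow> f (lam i t) = gam i (f t)"
    and "\<And>u v. u \<in> \<B> - {bullet} \<Longrightarrow> v \<in> \<B> - {bullet} \<Longrightarrow> f (u \<oplus> v) = f v \<oslash> f u"
    and "t \<in> \<B>"
  shows "f t = h t"
  using assms(4)
proof (induction t rule: h.induct)
  case (1 l)
  then show ?case using assms(1) by (simp add: \<B>_def)
next
  case (2 l c)
  let ?u = "root_tree (children c)"
  have u: "?u \<in> \<B>"
    using 2(2) by (intro root_tree_in_beta) (cases c, auto simp: \<B>_def)
  have "1 \<le> l" "l \<le> root_label ?u" "Node l [c] = lam l ?u"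
    using 2(2) by (cases c, auto simp: \<B>_def root_tree_def label_sum_def split: if_splits)+
  then have "f (Node l [c]) = gam l (f ?u)"
    using assms(2)[OF u] by simp
  then show ?case using 2(1)[OF u] by simp
next
  case (3 l c d cs)
  have ok: "root_tree [c] \<in> \<B> - {bullet}" "root_tree (d # cs) \<in> \<B> - {bullet}"
    using 3(3) root_tree_in_beta[of "[c]"] root_tree_in_beta[of "d # cs"]
    by (auto simp: \<B>_def) (auto simp: root_tree_def)
  have "Node l (c # d # cs) = root_tree [c] \<oplus> root_tree (d # cs)"
    using 3 by (auto simp: \<B>_def root_tree_def label_sum_def)
  then have "f (Node l (c # d # cs)) = f (root_tree (d # cs)) \<oslash> f (root_tree [c])"
    using assms(3)[OF ok] by simp
  then show ?case using 3(1,2) ok by simp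
qed

end

theory Submission
  imports Defs
begin

text \<open>
  Under \<open>h\<close> the pair of operations \<open>\<lambda>\<^sub>i\<close>, \<open>\<oplus>\<close> is exchanged with the pair \<open>\<gamma>\<^sub>i\<close>, \<open>\<oslash>\<close>: besides the
  defining equations one has \<open>h (\<gamma>\<^sub>i t) = \<lambda>\<^sub>i (h t)\<close> and \<open>h (u \<oslash> v) = h v \<oplus> h u\<close>, because
  \<open>\<oslash>\<close> and \<open>\<gamma>\<^sub>i\<close> only alter the last summand of a \<open>\<oplus>\<close>-decomposition and commute (up to a shift of
  the index) with \<open>\<lambda>\<^sub>k\<close>. Hence \<open>h\<close> is an involution. The equalities
  \<open>leaves t = int (h t)\<close>, \<open>root t = rpath (h t)\<close>, \<open>sub t = rsub (h t)\<close> follow by induction from the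
  behaviour of the statistics under the operations, and the other three
  are these applied to \<open>h t\<close>.
\<close>

section \<open>Decomposition of trees\<close>

lemma nonroot_ok_label: "nonroot_ok t \<Longrightarrow> 1 \<le> root_label t"
  by (cases t) auto

lemma beta_nonroot_ok: "t \<in> \<B> \<Longrightarrow> nonroot_ok t"
  by (cases t) (auto simp: \<B>_def split: if_splits)

lemma bullet_in_B: "bullet \<in> \<B>"
  by (simp add: \<B>_def)

lemma label_sum_append [simp]: "label_sum (cs @ ds) = label_sum cs + label_sum ds"
  by (simp add: label_sum_def)

lemma label_sum_simps [simp]:
  "label_sum [] = 0" "label_sum (c # cs) = root_label c + label_sum cs"
  by (simp_all add: label_sum_def)

lemma label_sum_pos:
  assumes "cs \<noteq> []" "\<forall>c\<in>set cs. nonroot_ok c"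
  shows "1 \<le> label_sum cs"
  using assms nonroot_ok_label[of "hd cs"] by (cases cs) auto

lemma beta_nonbullet_iff:
  "Node l cs \<in> \<B> - {bullet} \<longleftrightarrow> cs \<noteq> [] \<and> l = label_sum cs \<and> (\<forall>c\<in>set cs. nonroot_ok c)"
  using label_sum_pos[of cs] by (auto simp: \<B>_def)

lemma lam_in_B:
  assumes "t \<in> \<B>" "1 \<le> i" "i \<le> root_label t"
  shows "lam i t \<in> \<B> - {bullet}"
  using assms by (cases t) (auto simp: \<B>_def split: if_splits)

text \<open>Induction along the three forms of a tree in \<open>\<B>\<close>, so that later proofs
  can argue about operations instead of lists of children. A root with several children is split
  after its first child, and \<open>root_tree\<close> restores the root labels of the
  pieces.\<close>

lemma beta_induct [consumes 1, case_names bullet lam oplus]: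
  assumes "t \<in> \<B>"
    and "P bullet"
    and lam: "\<And>i t. t \<in> \<B> \<Longrightarrow> 1 \<le> i \<Longrightarrow> i \<le> root_label t \<Longrightarrow> P t \<Longrightarrow> P (lam i t)"
    and oplus: "\<And>u v. u \<in> \<B> - {bullet} \<Longrightarrow> v \<in> \<B> - {bullet} \<Longrightarrow> P u \<Longrightarrow> P v \<Longrightarrow> P (u \<oplus> v)"
  shows "P t"
  using assms(1)
proof (induction t rule: h.induct)
  case (1 l)
  then show ?case using assms(2) by (simp add: \<B>_def)
next
  case (2 l c)
  let ?u = "root_tree (children c)"
  have u: "?u \<in> \<B>"
    using 2(2) by (intro root_tree_in_beta) (cases c, auto simp: \<B>_def)
  have "1 \<le> l" "l \<le> root_label ?u" "Node l [c] = lam l ?u"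
    using 2(2) by (cases c, auto simp: \<B>_def root_tree_def split: if_splits)+
  then show ?case using lam[OF u] 2(1)[OF u] by simp
next
  case (3 l c d cs)
  have ok: "root_tree [c] \<in> \<B> - {bullet}" "root_tree (d # cs) \<in> \<B> - {bullet}"
    using 3(3) root_tree_in_beta[of "[c]"] root_tree_in_beta[of "d # cs"]
    by (auto simp: \<B>_def) (auto simp: root_tree_def)
  have "Node l (c # d # cs) = root_tree [c] \<oplus> root_tree (d # cs)"
    using 3(3) by (auto simp: \<B>_def root_tree_def)
  then show ?case using oplus[OF ok] 3(1,2) ok by simp
qed

section \<open>The operations and the right path\<close>

lemma rpath_Node: "rpath (Node l cs) = (if cs = [] then 0 else Suc (rpath (last cs)))"
  by (cases "last cs") (simp add: rpath_def)

lemma rpath_eq_0_iff: "t \<in> \<B> \<Longrightarrow> rpath t = 0 \<longleftrightarrow> t = bullet"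
  by (cases t) (auto simp: rpath_Node \<B>_def)

lemma rpath_lam: "rpath (lam i t) = Suc (rpath t)"
  by (cases t) (simp add: rpath_Node)

lemma rpath_oplus: "v \<in> \<B> - {bullet} \<Longrightarrow> rpath (u \<oplus> v) = rpath v"
  using children_nonempty[of v] by (cases u; cases v) (simp add: rpath_Node)

lemma rpath_oslash: "rpath (u \<oslash> v) = rpath u + rpath v"
proof (induction u v rule: oslash.induct)
  case (1 l cs v)
  have "rpath (Node 1 (children v)) = rpath v" by (cases v) (simp add: rpath_Node)
  with 1 show ?case by (simp add: rpath_Node)
qed

lemma root_label_attach: "1 \<le> i \<Longrightarrow> root_label (attach i t) = Suc (root_label t)"
  by (cases "(i, t)" rule: attach.cases) auto

text \<open>The \<open>i\<close>th node of the right path has depth \<open>i - 1\<close>; the new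
  leaf below it has depth \<open>i\<close> and ends the new right path.\<close>

lemma rpath_attach: "1 \<le> i \<Longrightarrow> i \<le> rpath t \<Longrightarrow> rpath (attach i t) = i"
  by (induction i t rule: attach.induct) (auto simp: rpath_Node split: if_splits)

lemma butlast_last_all:
  assumes "cs \<noteq> []" "\<forall>c\<in>set cs. P c"
  shows "\<forall>c\<in>set (butlast cs). P c" "P (last cs)"
  using assms by (auto dest: in_set_butlastD)

lemma label_sum_butlast_last:
  "cs \<noteq> [] \<Longrightarrow> label_sum (butlast cs) + root_label (last cs) = label_sum cs"
  by (induction cs) auto

text \<open>At every altered node, both the label and the sum of the children's labels grow by 1:
  above the chosen node through the altered last child, at the chosen node through the new leaf. The
  bound on \<open>i\<close> keeps the chosen node from being the rightmost leaf.\<close>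

lemma nonroot_ok_attach:
  "1 \<le> i \<Longrightarrow> i \<le> rpath t \<Longrightarrow> nonroot_ok t \<Longrightarrow> nonroot_ok (attach i t)"
proof (induction i t rule: attach.induct)
  case (3 i l cs)
  from 3(3) have ne: "cs \<noteq> []" and le: "Suc i \<le> rpath (last cs)"
    by (auto simp: rpath_Node split: if_splits)
  from 3(4) ne have ok: "\<forall>c\<in>set cs. nonroot_ok c" and l: "l \<le> label_sum cs" by auto
  note bl = butlast_last_all[OF ne ok]
  have "nonroot_ok (attach (Suc i) (last cs))"
    using 3(1)[OF ne _ le bl(2)] by simp
  then show ?case
    using ne l bl label_sum_butlast_last[OF ne] by (auto simp: root_label_attach)
qed (auto simp: rpath_Node split: if_splits)

lemma attach_in_B:
  assumes "1 \<le> i" "i \<le> rpath t" "t \<in> \<B>"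
  shows "attach i t \<in> \<B> - {bullet}"
proof (cases "(i, t)" rule: attach.cases)
  case (2 l cs)
  then show ?thesis using assms by (auto simp: \<B>_def rpath_Node split: if_splits)
next
  case (3 j l cs)
  then have ne: "cs \<noteq> []" and le: "Suc j \<le> rpath (last cs)"
    using assms by (auto simp: rpath_Node split: if_splits)
  have ok: "\<forall>c\<in>set cs. nonroot_ok c" and l: "l = label_sum cs"
    using assms 3 ne by (auto simp: \<B>_def)
  note bl = butlast_last_all[OF ne ok]
  have "nonroot_ok (attach (Suc j) (last cs))"
    using nonroot_ok_attach[OF _ le bl(2)] by simp
  then show ?thesis
    using 3 ne l bl label_sum_butlast_last[OF ne]
    by (simp add: beta_nonbullet_iff[simplified] root_label_attach)
      (auto simp: \<B>_def root_label_attach)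
qed (use assms in simp)

text \<open>If \<open>u\<close> is a leaf, its label is 1, which is also the label that the glued
  node receives.\<close>

lemma root_label_oslash: "nonroot_ok u \<Longrightarrow> root_label (u \<oslash> v) = root_label u"
  by (cases u) auto

text \<open>The glued node has label 1, and the children it takes over from \<open>v\<close> have a
  positive label sum. Above it no label changes.\<close>

lemma nonroot_ok_oslash:
  "nonroot_ok u \<Longrightarrow> v \<in> \<B> - {bullet} \<Longrightarrow> nonroot_ok (u \<oslash> v)"
proof (induction u v rule: oslash.induct)
  case (1 l cs v)
  show ?case
  proof (cases "cs = []")
    case True
    obtain r ds where v: "v = Node r ds" by (cases v)
    from 1(3)[unfolded v beta_nonbullet_iff] have "ds \<noteq> []" "\<forall>c\<in>set ds. nonroot_ok c"
      by blast+
    with True v label_sum_pos[of ds] show ?thesis by simp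
  next
    case False
    then have ok: "\<forall>c\<in>set cs. nonroot_ok c" and l: "1 \<le> l" "l \<le> label_sum cs"
      using 1(2) by auto
    note bl = butlast_last_all[OF False ok]
    have "nonroot_ok (last cs \<oslash> v)" by (rule 1(1)[OF False bl(2) 1(3)])
    then show ?thesis
      using False l bl label_sum_butlast_last[OF False] by (auto simp: root_label_oslash)
  qed
qed

lemma oslash_in_B:
  assumes "u \<in> \<B> - {bullet}" "v \<in> \<B> - {bullet}"
  shows "u \<oslash> v \<in> \<B> - {bullet}"
proof (cases u)
  case (Node l cs)
  from assms(1)[unfolded Node beta_nonbullet_iff]
  have ne: "cs \<noteq> []" and l: "l = label_sum cs" and ok: "\<forall>c\<in>set cs. nonroot_ok c"
    by blast+
  note bl = butlast_last_all[OF ne ok]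
  have "Node l (butlast cs @ [last cs \<oslash> v]) \<in> \<B> - {bullet}"
    unfolding beta_nonbullet_iff
    using bl nonroot_ok_oslash[OF bl(2) assms(2)] l label_sum_butlast_last[OF ne]
    by (auto simp: root_label_oslash)
  then show ?thesis unfolding Node using ne by simp
qed

lemma gam_nonbullet: "t \<noteq> bullet \<Longrightarrow> gam i t = attach i t"
  by (simp add: gam_def)

section \<open>Statistics under the operations and under h\<close>

lemma leaves_oplus:
  "u \<in> \<B> - {bullet} \<Longrightarrow> v \<in> \<B> - {bullet} \<Longrightarrow> leaves (u \<oplus> v) = leaves u + leaves v"
  using children_nonempty[of u] children_nonempty[of v] by (cases u; cases v) simp

lemma leaves_lam: "leaves (lam i t) = leaves t"
  by (cases t) auto

lemma sum_list_butlast_last: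
  fixes f :: "'a \<Rightarrow> nat"
  assumes "cs \<noteq> []"
  shows "sum_list (map f cs) = sum_list (map f (butlast cs)) + f (last cs)"
  using assms by (induction cs) auto

text \<open>The glued node is internal exactly when the root of \<open>v\<close> is, and the leaf of
  \<open>u\<close> that it replaces counted 0.\<close>

lemma internals_oslash: "internals (u \<oslash> v) = internals u + internals v"
proof (induction u v rule: oslash.induct)
  case (1 l cs v)
  show ?case
  proof (cases "cs = []")
    case True
    then show ?thesis by (cases v) simp
  next
    case False
    then show ?thesis using 1 sum_list_butlast_last[OF False, of internals] by simp
  qed
qed

lemma internals_attach: "1 \<le> i \<Longrightarrow> i \<le> rpath t \<Longrightarrow> internals (attach i t) = internals t"
proof (induction i t rule: attach.induct)
  case (3 i l cs)
  from 3(3) have ne: "cs \<noteq> []" and le: "Suc i \<le> rpath (last cs)"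
    by (auto simp: rpath_Node split: if_splits)
  then show ?case using 3(1)[OF ne _ le] sum_list_butlast_last[OF ne, of internals] by simp
qed (auto simp: rpath_Node split: if_splits)

lemma root_sub_oplus: "root_sub (u \<oplus> v) = root_sub u + root_sub v"
  by (cases u; cases v) (simp add: root_sub_def)

lemma root_sub_lam: "root_sub (lam i t) = 1"
  by (cases t) (simp add: root_sub_def)

text \<open>The list of \<open>u\<close> ends with the 1 of its rightmost leaf. This is already the
  label of the glued node, so only the root entry of \<open>v\<close> is dropped.\<close>

lemma right_path_labels_oslash:
  "nonroot_ok u \<Longrightarrow> right_path_labels (u \<oslash> v) = right_path_labels u @ tl (right_path_labels v)"
proof (induction u v rule: oslash.induct)
  case (1 l cs v)
  then show ?case by (cases v) auto
qed

lemma rsub_oslash: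
  assumes "nonroot_ok u"
  shows "rsub (u \<oslash> v) = rsub u + rsub v"
proof -
  have "right_path_labels u \<noteq> []" by (cases u) simp
  then show ?thesis using assms by (simp add: rsub_def right_path_labels_oslash)
qed

text \<open>The right path now stops at the new leaf, and every node above that leaf had a positive
  label that was raised by 1.\<close>

lemma right_path_labels_attach:
  "1 \<le> i \<Longrightarrow> i \<le> rpath t \<Longrightarrow> nonroot_ok t \<Longrightarrow>
    \<exists>ls. right_path_labels (attach i t) = ls @ [1] \<and> ls \<noteq> [] \<and> (\<forall>l\<in>set ls. 1 < l)"
proof (induction i t rule: attach.induct)
  case (2 l cs)
  then show ?case by (intro exI[of _ "[l + 1]"]) auto
next
  case (3 i l cs)
  from 3(3) have ne: "cs \<noteq> []" and le: "Suc i \<le> rpath (last cs)"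
    by (auto simp: rpath_Node split: if_splits)
  obtain ls where "right_path_labels (attach (Suc i) (last cs)) = ls @ [1]" "\<forall>l\<in>set ls. 1 < l"
    using 3(1)[OF ne _ le] 3(4) ne by auto
  then show ?case using 3(4) ne by (intro exI[of _ "(l + 1) # ls"]) auto
qed simp

lemma rsub_attach:
  assumes "1 \<le> i" "i \<le> rpath t" "nonroot_ok t"
  shows "rsub (attach i t) = 1"
proof -
  obtain ls where ls: "right_path_labels (attach i t) = ls @ [1]" "ls \<noteq> []" "\<forall>l\<in>set ls. 1 < l"
    using right_path_labels_attach[OF assms] by blast
  \<comment> \<open>Since \<open>ls\<close> is nonempty, \<open>tl\<close> removes the root label
    and leaves the final 1 in place.\<close>
  then have "filter (\<lambda>l. l = 1) (tl ls) = []"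
    by (auto simp: filter_empty_conv dest!: list.set_sel(2))
  with ls show ?thesis by (simp add: rsub_def)
qed

lemma h_lam_bullet: "h (lam i bullet) = Node 1 [bullet]"
  by (simp add: root_tree_def gam_def)

text \<open>Membership and the equality of \<open>root_label t\<close> with
  \<open>rpath (h t)\<close> have to share one induction: the equality puts the index of
  \<open>gam\<close> in range, which is what keeps \<open>h t\<close> inside \<open>\<B>\<close>.
  The three remaining statistics are left to the involution.\<close>

lemma h_properties:
  assumes "t \<in> \<B>"
  shows "h t \<in> \<B> \<and> (t \<noteq> bullet \<longrightarrow> h t \<noteq> bullet \<and> leaves t = internals (h t) \<and>
    root_label t = rpath (h t) \<and> root_sub t = rsub (h t))"
  using assms
proof (induction rule: beta_induct)
  case bullet
  then show ?case by (simp add: \<B>_def)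
next
  case (lam i t)
  show ?case
  proof (cases "t = bullet")
    case True
    then have "h (lam i t) = Node 1 [bullet]" by (simp only: h_lam_bullet)
    with True lam show ?thesis
      by (simp add: \<B>_def rpath_def rsub_def root_sub_def)
  next
    case False
    with lam have i: "1 \<le> i" "i \<le> rpath (h t)" and ht: "h t \<in> \<B>" "h t \<noteq> bullet" by auto
    have "root_label (lam i t) = i" by (cases t) simp
    moreover have "attach i (h t) \<in> \<B> - {bullet}" by (rule attach_in_B[OF i ht(1)])
    ultimately show ?thesis
      using lam False h_lam[OF lam(1-3)] gam_nonbullet[OF ht(2)] rpath_attach[OF i]
        internals_attach[OF i] rsub_attach[OF i beta_nonroot_ok[OF ht(1)]]
      by (simp add: leaves_lam root_sub_lam)
  qed
next
  case (oplus u v)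
  then have hu: "h u \<in> \<B> - {bullet}" and hv: "h v \<in> \<B> - {bullet}" by auto
  have "root_label (u \<oplus> v) = root_label u + root_label v" by (cases u; cases v) simp
  then show ?case
    using oplus h_oplus[OF oplus(1,2)] oslash_in_B[OF hv hu] leaves_oplus[OF oplus(1,2)] hv
    by (simp add: internals_oslash rpath_oslash root_sub_oplus rsub_oslash beta_nonroot_ok)
qed

lemma h_in_B: "t \<in> \<B> \<Longrightarrow> h t \<in> \<B>"
  by (simp only: h_properties)

lemma h_nonbullet: "t \<in> \<B> - {bullet} \<Longrightarrow> h t \<in> \<B> - {bullet}"
  using h_properties[of t] by (simp only: Diff_iff singleton_iff) blast

section \<open>The mirrored recursion and the involution\<close>

text \<open>The rightmost leaf of \<open>u \<oplus> v\<close> lies in \<open>v\<close>.\<close>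

lemma oplus_oslash: "v \<in> \<B> - {bullet} \<Longrightarrow> (u \<oplus> v) \<oslash> w = u \<oplus> (v \<oslash> w)"
  using children_nonempty[of v] by (cases u; cases v) (simp add: butlast_append)

lemma lam_oslash: "w \<in> \<B> - {bullet} \<Longrightarrow> lam i w \<oslash> v = lam i (w \<oslash> v)"
  using children_nonempty[of w] by (cases w) simp

text \<open>Below the root, the right path of \<open>u \<oplus> v\<close> is that of
  \<open>v\<close>; at the root, the increment can be charged to the summand
  \<open>v\<close>.\<close>

lemma attach_oplus:
  assumes "1 \<le> i" "v \<in> \<B> - {bullet}"
  shows "attach i (u \<oplus> v) = u \<oplus> attach i v"
  using assms children_nonempty[of v]
  by (cases "(i, v)" rule: attach.cases; cases u) (simp_all add: butlast_append)

lemma attach_1: "attach (Suc 0) t = t \<oplus> lam 1 bullet"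
  by (cases t) simp

text \<open>Induction on \<open>u\<close>. The base is \<open>lam 1 bullet\<close>, where gluing
  amounts to \<open>lam 1\<close> and \<open>h\<close> turns it into a new last summand. For larger
  \<open>u\<close>, the gluing is pushed inside, and the result is reassembled on the image side by
  \<open>attach_oplus\<close> or \<open>oplus_oslash\<close>.\<close>

lemma h_oslash:
  assumes "u \<in> \<B>" "u \<noteq> bullet" "v \<in> \<B> - {bullet}"
  shows "h (u \<oslash> v) = h v \<oplus> h u"
  using assms(1,2)
proof (induction rule: beta_induct)
  case (lam i w)
  note hv = h_nonbullet[OF assms(3)]
  show ?case
  proof (cases "w = bullet")
    case True
    then have i: "i = 1" using lam by simp
    have "h (lam i w) = lam 1 bullet" unfolding True h_lam_bullet by simp
    \<comment> \<open>Gluing resets the root label of \<open>v\<close> to 1, exactly as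
      \<open>lam 1\<close> does.\<close>
    moreover have "lam i w \<oslash> v = lam 1 v" using True i by (cases v) simp
    moreover have "1 \<le> root_label v"
      using assms(3) by (auto intro: nonroot_ok_label[simplified] beta_nonroot_ok)
    then have "h (lam 1 v) = attach 1 (h v)"
      using h_lam[of v 1] assms(3) hv by (simp add: gam_nonbullet)
    ultimately show ?thesis by (simp add: attach_1)
  next
    case False
    then have w: "w \<in> \<B> - {bullet}" using lam by simp
    note hw = h_nonbullet[OF w]
    note wv = oslash_in_B[OF w assms(3)]
    have rl: "root_label (w \<oslash> v) = root_label w"
      using lam by (simp add: root_label_oslash beta_nonroot_ok)
    have "h (lam i w \<oslash> v) = gam i (h (w \<oslash> v))"
      unfolding lam_oslash[OF w] using wv lam rl by (simp add: h_lam)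
    also have "\<dots> = attach i (h v \<oplus> h w)"
      using h_nonbullet[OF wv] lam(4)[OF False] by (simp add: gam_nonbullet)
    also have "\<dots> = h v \<oplus> attach i (h w)"
      by (rule attach_oplus[OF lam(2) hw])
    also have "\<dots> = h v \<oplus> h (lam i w)"
      using hw lam by (simp add: h_lam gam_nonbullet)
    finally show ?thesis .
  qed
next
  case (oplus a b)
  have "h ((a \<oplus> b) \<oslash> v) = h (a \<oplus> (b \<oslash> v))"
    by (simp only: oplus_oslash[OF oplus(2)])
  also have "\<dots> = h (b \<oslash> v) \<oslash> h a"
    by (rule h_oplus[OF oplus(1) oslash_in_B[OF oplus(2) assms(3)]])
  also have "\<dots> = (h v \<oplus> h b) \<oslash> h a" using oplus by simp
  also have "\<dots> = h v \<oplus> (h b \<oslash> h a)" by (rule oplus_oslash[OF h_nonbullet[OF oplus(2)]])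
  also have "\<dots> = h v \<oplus> h (a \<oplus> b)" by (simp only: h_oplus[OF oplus(1,2)])
  finally show ?case by simp
qed simp

text \<open>The index \<open>i\<close> is generalized because passing below the root of
  \<open>lam k u\<close> lowers it by 1. The key is that \<open>attach (Suc j)\<close> on
  \<open>lam k\<close> equals \<open>lam (Suc k)\<close> on \<open>attach j\<close>, a rule
  symmetric under exchanging the two operations with their indices.\<close>

lemma h_attach:
  assumes "t \<in> \<B>" "1 \<le> i" "i \<le> rpath t"
  shows "h (attach i t) = lam i (h t)"
  using assms
proof (induction arbitrary: i rule: beta_induct)
  case bullet
  then show ?case by (simp add: rpath_Node)
next
  case (lam k u)
  note t = lam_in_B[OF lam(1-3)]
  show ?case
  proof (cases "i = 1")
    case True
    \<comment> \<open>For \<open>i = 1\<close> the new leaf is a last summand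
      \<open>lam 1 bullet\<close>. By \<open>h_oplus\<close> its image becomes the left factor of a
      gluing, and gluing onto a single edge is \<open>lam 1\<close>.\<close>
    have "lam 1 bullet \<in> \<B> - {bullet}" by (rule lam_in_B[OF bullet_in_B]) simp_all
    from h_oplus[OF t this, unfolded h_lam_bullet] have "h (attach i (lam k u)) = Node 1 [bullet] \<oslash> h (lam k u)"
      by (simp only: True attach_1 One_nat_def)
    then show ?thesis using True by (cases "h (lam k u)") simp
  next
    case False
    then obtain j where j: "i = Suc j" "1 \<le> j" "j \<le> rpath u"
      using lam(5,6) by (cases i) (auto simp: rpath_lam)
    then have u: "u \<in> \<B> - {bullet}"
      using lam(1) rpath_eq_0_iff[of u] by auto
    have at: "attach i (lam k u) = lam (Suc k) (attach j u)"
      using j by (cases "(j, u)" rule: attach.cases) auto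
    have "h (attach i (lam k u)) = gam (Suc k) (h (attach j u))"
      unfolding at using attach_in_B[OF j(2,3) lam(1)] lam(3) root_label_attach[OF j(2), of u]
      by (intro h_lam) auto
    also have "\<dots> = gam (Suc k) (lam j (h u))" by (simp add: lam(4)[OF j(2,3)])
    also have "\<dots> = attach (Suc k) (lam j (h u))"
      by (cases "h u") (simp add: gam_def)
    \<comment> \<open>The same commutation with the roles of \<open>j\<close> and \<open>k\<close>
      exchanged.\<close>
    also have "\<dots> = lam i (attach k (h u))"
      using lam(2) j(1) by (cases "(k, h u)" rule: attach.cases) auto
    also have "\<dots> = lam i (h (lam k u))"
      using h_nonbullet[OF u] lam by (simp add: h_lam gam_nonbullet)
    finally show ?thesis .
  qed
next
  case (oplus u v)
  then have v: "attach i v \<in> \<B> - {bullet}"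
    by (intro attach_in_B) (auto simp: rpath_oplus)
  have "h (attach i (u \<oplus> v)) = h (u \<oplus> attach i v)"
    by (simp only: attach_oplus[OF oplus(5,2)])
  also have "\<dots> = h (attach i v) \<oslash> h u" by (rule h_oplus[OF oplus(1) v])
  also have "\<dots> = lam i (h v) \<oslash> h u" using oplus by (simp add: rpath_oplus)
  also have "\<dots> = lam i (h v \<oslash> h u)" by (rule lam_oslash[OF h_nonbullet[OF oplus(2)]])
  also have "\<dots> = lam i (h (u \<oplus> v))" by (simp only: h_oplus[OF oplus(1,2)])
  finally show ?case .
qed

text \<open>\<open>h\<close> takes \<open>lam\<close> to \<open>gam\<close> and \<open>gam\<close>
  back to \<open>lam\<close>, and the order reversals in \<open>h_oplus\<close> and
  \<open>h_oslash\<close> cancel.\<close>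

lemma h_involution:
  assumes "t \<in> \<B>"
  shows "h (h t) = t"
  using assms
proof (induction rule: beta_induct)
  case (lam i t)
  show ?case
  proof (cases "t = bullet")
    case True
    with lam have "i = 1" by simp
    with True show ?thesis using h_lam_bullet[of 1] by simp
  next
    case False
    then have "h t \<in> \<B> - {bullet}" "i \<le> rpath (h t)"
      using lam h_properties[OF lam(1)] by auto
    then show ?thesis using lam by (simp add: h_lam gam_nonbullet h_attach)
  qed
next
  case (oplus u v)
  then show ?case
    using h_nonbullet[OF oplus(1)] h_nonbullet[OF oplus(2)] by (simp add: h_oplus h_oslash)
qed simp

theorem theorem6:
  shows "h \<in> \<B> \<rightarrow> \<B>
    \<and> (\<forall>t\<in>\<B>. h (h t) = t)
    \<and> (\<forall>t\<in>\<B>. children t \<noteq> [] \<longrightarrow>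
        leaves t = internals (h t) \<and>
        internals t = leaves (h t) \<and>
        root_label t = rpath (h t) \<and>
        rpath t = root_label (h t) \<and>
        root_sub t = rsub (h t) \<and>
        rsub t = root_sub (h t))"
proof (intro conjI[of "h \<in> \<B> \<rightarrow> \<B>"] conjI[of "\<forall>t\<in>\<B>. h (h t) = t"] ballI impI)
  show "h \<in> \<B> \<rightarrow> \<B>" by (simp add: h_in_B)
next
  fix t
  assume "t \<in> \<B>"
  then show "h (h t) = t" by (rule h_involution)
next
  fix t
  assume t: "t \<in> \<B>" "children t \<noteq> []"
  then have "t \<noteq> bullet" by auto
  \<comment> \<open>\<open>h_properties\<close> for \<open>h t\<close>, rewritten with
    \<open>h (h t) = t\<close>, supplies the three equalities in the opposite direction.\<close>
  with t h_properties[OF t(1)] h_properties[OF h_in_B[OF t(1)]] h_involution[OF t(1)]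
  show "leaves t = internals (h t) \<and> internals t = leaves (h t) \<and> root_label t = rpath (h t) \<and>
      rpath t = root_label (h t) \<and> root_sub t = rsub (h t) \<and> rsub t = root_sub (h t)"
    by simp
qed

end
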